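(* Let $c\geq 0$ be fixed. For $n\in\mathbb{N}$ let the lollipop $L(n,c)$ be the graph obtained from a complete graph $K_{\lfloor cn\rfloor}$ and a path $P_n$ on $n$ vertices, one end of the path being a vertex of the clique. Then \[\mathrm{dct}(L(n,c))=\begin{cases}(1+o(1))\frac{n}{4}\cdot\frac{(\sqrt2-1+c)(\sqrt2+1-c)}{1+c}, & c\in[0,1],\\ (1+o(1))\frac{n}{2(1+c)}, & c>1,\end{cases}\] and the cost of drunkenness is \[F(L(n,c))=\frac{\mathrm{ct}(L(n,c))}{\mathrm{dct}(L(n,c))}=\begin{cases}\frac{2(1+c)}{(\sqrt2-1+c)(\sqrt2+1-c)}+o(1), & c\in[0,1],\\ (1+c)+o(1), & c>1,\end{cases}\] where asymptotics are as $n\to\infty$.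
   Context: Cops and robber game on a finite connected graph $G=(V,E)$ with $k$ cops: in round $0$ the cops choose positions $x\in V^k$, then the robber chooses his initial vertex; in each round $t\ge1$ first each cop moves along an edge or stays, then the robber moves. Capture time is the first time a cop and the robber occupy the same vertex. The cop number $c(G)$ is the minimum $k$ for which the cops can guarantee capture of a robber who sees everything and plays optimally ($c(L(n,c))=1$). $\mathrm{ct}_{x,y}(G,k)$ is the capture time from $(x,y)$ under optimal play (cops minimizing, robber maximizing); $\mathrm{ct}(G,k)=\min_{x}\max_{y}\mathrm{ct}_{x,y}(G,k)$ and $\mathrm{ct}(G)=\mathrm{ct}(G,c(G))$. In the drunk robber version, after the cops choose $x$ the robber's initial vertex is uniformly random in $V$, and in each round the robber moves to a uniformly random neighbour of his current vertex (open neighbourhood; he never stays), independently of the cops; the cops see him. $\mathrm{dct}_{x,y}(G,k)$ is the expected capture time from $(x,y)$ when the cops play to minimize it, $\mathrm{dct}(G,k)=\min_{x\in V^k}\frac{1}{|V|}\sum_{y\in V}\mathrm{dct}_{x,y}(G,k)$, $\mathrm{dct}(G)=\mathrm{dct}(G,c(G))$, and $F(G)=\mathrm{ct}(G)/\mathrm{dct}(G)$. *)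

theory Defs
  imports
    "HOL-Probability.Probability"
    "HOL-Library.Landau_Symbols"
    "HOL-Library.Extended_Nat"
    "Graph_Theory.Graph_Theory"
begin

section \<open>Playing the game\<close>

text \<open>A finite simple graph is a \<^locale>\<open>pair_graph\<close>, i.e. a finite loop-free symmetric
  digraph. The games below are of interest for connected graphs.\<close>

definition neighbours :: "'a pair_pre_digraph \<Rightarrow> 'a \<Rightarrow> 'a set" where
  "neighbours G v = {w. (v, w) \<in> parcs G}"

definition stay_or_move :: "'a pair_pre_digraph \<Rightarrow> 'a \<Rightarrow> 'a \<Rightarrow> bool" where
  "stay_or_move G v w \<longleftrightarrow> w = v \<or> w \<in> neighbours G v"

definition cop_positions :: "'a pair_pre_digraph \<Rightarrow> nat \<Rightarrow> 'a list set" where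
  "cop_positions G k = {xs. length xs = k \<and> set xs \<subseteq> pverts G}"

text \<open>A history lists the pairs (cop positions, robber position) at the ends of the rounds
  \<open>t, t - 1, \<dots>, 0\<close>, most recent first.\<close>

type_synonym 'a history = "('a list \<times> 'a) list"

text \<open>A cop strategy yields the next cop positions from the history. A robber strategy also gets
  the new cop positions, because within a round the cops move first.\<close>

type_synonym 'a cop_strategy = "'a history \<Rightarrow> 'a list"
type_synonym 'a robber_strategy = "'a history \<Rightarrow> 'a list \<Rightarrow> 'a"

definition cop_strategies :: "'a pair_pre_digraph \<Rightarrow> nat \<Rightarrow> 'a cop_strategy set" where
  "cop_strategies G k = {\<sigma>. \<forall>x y h. x \<in> cop_positions G k \<longrightarrow> y \<in> pverts G \<longrightarrow>
      list_all2 (stay_or_move G) x (\<sigma> ((x, y) # h))}"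

definition robber_strategies :: "'a pair_pre_digraph \<Rightarrow> 'a robber_strategy set" where
  "robber_strategies G = {\<rho>. \<forall>x y h x'. y \<in> pverts G \<longrightarrow>
      stay_or_move G y (\<rho> ((x, y) # h) x')}"

text \<open>The robber's rule of play \<open>r\<close> takes the number of completed rounds as an additional
  argument, so that it also covers the drunk robber, whose move in each round is
  prescribed by fresh randomness.\<close>

primrec play :: "'a cop_strategy \<Rightarrow> (nat \<Rightarrow> 'a robber_strategy) \<Rightarrow> 'a list \<Rightarrow> 'a \<Rightarrow> nat \<Rightarrow> 'a history"
where
  "play \<sigma> r x y 0 = [(x, y)]"
| "play \<sigma> r x y (Suc t) =
     (let h = play \<sigma> r x y t; x' = \<sigma> h in (x', r t h x') # h)"

text \<open>In round \<open>t\<close> capture happens after the cops' move (when a cop steps onto the robber's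
  vertex of round \<open>t - 1\<close>) or after the robber's move. The play is formally continued
  after a capture; this does not affect the first capture. The value is \<open>\<infinity>\<close> if the
  robber is never captured.\<close>

definition capture_time :: "(nat \<Rightarrow> 'a history) \<Rightarrow> enat" where
  "capture_time H = (INF t \<in> {t. snd (hd (H t)) \<in> set (fst (hd (H t))) \<or>
      (\<exists>s. t = Suc s \<and> snd (hd (H s)) \<in> set (fst (hd (H t))))}. enat t)"


section \<open>The adversarial robber\<close>

definition cops_can_win :: "'a pair_pre_digraph \<Rightarrow> nat \<Rightarrow> bool" where
  "cops_can_win G k \<longleftrightarrow> (\<exists>x \<in> cop_positions G k. \<exists>\<sigma> \<in> cop_strategies G k.
      \<forall>y \<in> pverts G. \<forall>\<rho> \<in> robber_strategies G. capture_time (play \<sigma> (\<lambda>_. \<rho>) x y) < \<infinity>)"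

definition cop_number :: "'a pair_pre_digraph \<Rightarrow> nat" where
  "cop_number G = (LEAST k. cops_can_win G k)"

definition ct_from :: "'a pair_pre_digraph \<Rightarrow> nat \<Rightarrow> 'a list \<Rightarrow> 'a \<Rightarrow> enat" where
  "ct_from G k x y = (INF \<sigma> \<in> cop_strategies G k. SUP \<rho> \<in> robber_strategies G.
      capture_time (play \<sigma> (\<lambda>_. \<rho>) x y))"

definition ct_with :: "'a pair_pre_digraph \<Rightarrow> nat \<Rightarrow> enat" where
  "ct_with G k = (INF x \<in> cop_positions G k. SUP y \<in> pverts G. ct_from G k x y)"

definition ct :: "'a pair_pre_digraph \<Rightarrow> enat" where
  "ct G = ct_with G (cop_number G)"


section \<open>The drunk robber\<close>

text \<open>The randomness is a sequence of independent random maps on the vertices, each of which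
  sends the vertices independently to uniformly random neighbours. In the \<open>t\<close>-th round the
  robber moves to the image of his current vertex under the \<open>t\<close>-th map; thus, conditionally
  on the past, he moves to a uniformly random neighbour. Cop strategies depend on the history
  only, hence not on future random maps.\<close>

definition random_moves :: "'a pair_pre_digraph \<Rightarrow> ('a \<Rightarrow> 'a) stream measure" where
  "random_moves G = stream_space (measure_pmf
      (Pi_pmf (pverts G) undefined (\<lambda>v. pmf_of_set (neighbours G v))))"

definition drunk_robber :: "('a \<Rightarrow> 'a) stream \<Rightarrow> nat \<Rightarrow> 'a robber_strategy" where
  "drunk_robber \<omega> t h x' = (\<omega> !! t) (snd (hd h))"

definition dct_from :: "'a pair_pre_digraph \<Rightarrow> nat \<Rightarrow> 'a list \<Rightarrow> 'a \<Rightarrow> ennreal" where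
  "dct_from G k x y = (INF \<sigma> \<in> cop_strategies G k.
      \<integral>\<^sup>+ \<omega>. ennreal_of_enat (capture_time (play \<sigma> (drunk_robber \<omega>) x y)) \<partial>random_moves G)"

definition dct_with :: "'a pair_pre_digraph \<Rightarrow> nat \<Rightarrow> ennreal" where
  "dct_with G k = (INF x \<in> cop_positions G k.
      (\<Sum>y \<in> pverts G. dct_from G k x y) / of_nat (card (pverts G)))"

definition dct :: "'a pair_pre_digraph \<Rightarrow> ennreal" where
  "dct G = dct_with G (cop_number G)"

definition cost_of_drunkenness :: "'a pair_pre_digraph \<Rightarrow> ennreal" where
  "cost_of_drunkenness G = ennreal_of_enat (ct G) / dct G"

text \<open>The integrand in \<^const>\<open>dct_from\<close> is measurable, so the integral is a genuine expectation.\<close>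

lemma measurable_drunk_play:
  fixes G :: "'a::countable pair_pre_digraph"
  shows "(\<lambda>\<omega>. play \<sigma> (drunk_robber \<omega>) x y t) \<in> random_moves G \<rightarrow>\<^sub>M count_space UNIV"
proof (induction t)
  case 0
  show ?case by simp
next
  case (Suc t)
  let ?p = "Pi_pmf (pverts G) undefined (\<lambda>v. pmf_of_set (neighbours G v))"
  have "(\<lambda>\<omega>. (\<omega> !! t) v) \<in> random_moves G \<rightarrow>\<^sub>M count_space UNIV" for v
  proof -
    have "(\<lambda>f. f v) \<in> measure_pmf ?p \<rightarrow>\<^sub>M count_space UNIV"
      by simp
    from measurable_compose[OF measurable_snth this]
    show ?thesis unfolding random_moves_def .
  qed
  then have "(\<lambda>\<omega>. (\<sigma> h, (\<omega> !! t) (snd (hd h))) # h) \<in> random_moves G \<rightarrow>\<^sub>M count_space UNIV" for h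
    by (rule measurable_compose) simp
  from measurable_compose_countable[OF this Suc]
  show ?case by (simp add: Let_def drunk_robber_def)
qed

lemma measurable_drunk_capture_time:
  fixes G :: "'a::countable pair_pre_digraph"
  shows "(\<lambda>\<omega>. ennreal_of_enat (capture_time (play \<sigma> (drunk_robber \<omega>) x y)))
    \<in> borel_measurable (random_moves G)"
proof -
  note [measurable] = measurable_drunk_play
  let ?H = "\<lambda>\<omega>. play \<sigma> (drunk_robber \<omega>) x y"
  define C where "C H t \<longleftrightarrow> snd (hd (H t)) \<in> set (fst (hd (H t))) \<or>
      t \<noteq> 0 \<and> snd (hd (H (t - 1))) \<in> set (fst (hd (H t)))" for H :: "nat \<Rightarrow> 'a history" and t
  have "capture_time H = Inf (enat ` {t. C H t})" for H :: "nat \<Rightarrow> 'a history"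
    unfolding capture_time_def C_def
    by (rule arg_cong[where f = "\<lambda>A. Inf (enat ` A)"]) (auto simp: gr0_conv_Suc)
  also have "Inf (enat ` {t. C H t}) = (INF t. if C H t then enat t else \<infinity>)" for H
  proof (rule antisym)
    show "(INF t\<in>{t. C H t}. enat t) \<le> (INF t. if C H t then enat t else \<infinity>)"
      by (rule INF_greatest) (simp add: INF_lower)
    show "(INF t. if C H t then enat t else \<infinity>) \<le> (INF t\<in>{t. C H t}. enat t)"
    proof (rule INF_greatest)
      show "(INF t. if C H t then enat t else \<infinity>) \<le> enat t" if "t \<in> {t. C H t}" for t
        using that by (intro INF_lower2[of t]) auto
    qed
  qed
  finally have *: "capture_time H = (INF t. if C H t then enat t else \<infinity>)" for H .
  have [measurable]: "Measurable.pred (random_moves G) (\<lambda>\<omega>. C (?H \<omega>) t)" for t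
    unfolding C_def by measurable
  show ?thesis unfolding * by measurable
qed


section \<open>Lollipops\<close>

text \<open>The path has vertices \<open>0, \<dots>, n - 1\<close>, and the clique consists of the
  \<open>\<lfloor>c n\<rfloor>\<close> vertices from \<open>n - 1\<close> on, so that path and clique share the
  vertex \<open>n - 1\<close>. If \<open>\<lfloor>c n\<rfloor> = 0\<close> (in particular if \<open>c = 0\<close>), the
  lollipop is just the path.\<close>

definition lollipop :: "nat \<Rightarrow> real \<Rightarrow> nat pair_pre_digraph" where
  "lollipop n c =
     (let clique = {n - 1 ..< n - 1 + nat \<lfloor>c * real n\<rfloor>} in
      \<lparr>pverts = {..<n} \<union> clique,
       parcs = {(i, j). i < n \<and> j < n \<and> (j = Suc i \<or> i = Suc j)}
             \<union> {(i, j). i \<in> clique \<and> j \<in> clique \<and> i \<noteq> j}\<rparr>)"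

lemma pair_graph_lollipop: "pair_graph (lollipop n c)"
proof -
  have "finite (parcs (lollipop n c))"
    by (rule finite_subset[of _ "pverts (lollipop n c) \<times> pverts (lollipop n c)"])
       (auto simp: lollipop_def Let_def)
  then show ?thesis
    by unfold_locales (auto simp: lollipop_def Let_def symmetric_def sym_def)
qed

lemma connected_lollipop:
  assumes "n > 0"
  shows "Digraph_Component.connected (with_proj (lollipop n c))"
proof -
  let ?G = "lollipop n c"
  interpret pair_graph ?G by (rule pair_graph_lollipop)
  have path: "0 \<rightarrow>\<^sup>*\<^bsub>with_proj ?G\<^esub> i" if "i < n" for i
    using that
  proof (induction i)
    case 0
    then have "0 \<in> pverts ?G" by (auto simp: lollipop_def Let_def)
    then show ?case by simp
  next
    case (Suc i)
    then have "(i, Suc i) \<in> parcs ?G" by (auto simp: lollipop_def Let_def)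
    moreover have "0 \<rightarrow>\<^sup>*\<^bsub>with_proj ?G\<^esub> i" using Suc by simp
    ultimately show ?case by (rule reachable_adj_trans[rotated])
  qed
  have from0: "0 \<rightarrow>\<^sup>*\<^bsub>with_proj ?G\<^esub> v" if "v \<in> pverts ?G" for v
  proof (cases "v < n")
    case False
    then have "(n - 1, v) \<in> parcs ?G"
      using that assms by (auto simp: lollipop_def Let_def)
    moreover have "0 \<rightarrow>\<^sup>*\<^bsub>with_proj ?G\<^esub> (n - 1)" using assms by (intro path) simp
    ultimately show ?thesis by (rule reachable_adj_trans[rotated])
  qed (rule path)
  have "u \<rightarrow>\<^sup>*\<^bsub>with_proj ?G\<^esub> v" if "u \<in> pverts ?G" "v \<in> pverts ?G" for u v
    using symmetric_reachable[OF sym_arcs from0[OF that(1)]] from0[OF that(2)]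
    by (rule reachable_trans)
  moreover have "pverts ?G \<noteq> {}"
    using assms by (auto simp: lollipop_def Let_def)
  ultimately show ?thesis
    by (simp add: Digraph_Component.connected_def strongly_connected_def
        reachable_mk_symmetric_eq[OF sym_arcs])
qed

end

theory Submission
  imports Defs "HOL-Real_Asymp.Real_Asymp"
begin

text \<open>Collapse the clique onto the end \<open>n - 1\<close> of the path. Up to an error \<open>o(n)\<close>, the expected
  capture time from \<open>(x, y)\<close> is the distance of the two projections: a cop who walks towards the
  robber gains one unit per round, and the robber's projection is a martingale except at the two
  ends. Averaging over \<open>y\<close> and minimizing the resulting quadratic in \<open>x\<close> gives the constants.

  No concentration inequality is needed. For the chasing cop the distance plus the number of rounds
  is a supermartingale, because both boundary drifts point towards him. For the lower bound the
  robber's projection is replaced by a function that is constant near both ends and differs from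
  it by \<open>O(A)\<close>, where \<open>A\<close> is about \<open>\<surd>n\<close>; its drift is \<open>O(1 / A)\<close> everywhere, and the distance plus
  \<open>1 + O(1 / A)\<close> times the number of rounds is a submartingale for every cop strategy.\<close>

section \<open>The first round of a play\<close>

text \<open>A cop strategy may depend on the whole history, which lists the initial position last. After one
  round the game therefore restarts with the strategy that remembers the old initial position.\<close>

definition shift_strategy :: "'a cop_strategy \<Rightarrow> 'a list \<times> 'a \<Rightarrow> 'a cop_strategy" where
  "shift_strategy \<sigma> p = (\<lambda>h. \<sigma> (h @ [p]))"

lemma shift_strategy_in_cop_strategies:
  "\<sigma> \<in> cop_strategies G k \<Longrightarrow> shift_strategy \<sigma> p \<in> cop_strategies G k"
  unfolding cop_strategies_def shift_strategy_def by auto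

lemma play_nonempty [simp]: "play \<sigma> r x y t \<noteq> []"
  by (cases t) (auto simp: Let_def)

text \<open>Only nonempty histories ever reach the robber. A rule that reads \<open>hd h\<close>,
  like \<open>drunk_robber\<close>, ignores an old initial pair appended to such a history.\<close>

lemma play_cong:
  assumes "\<And>t h x'. h \<noteq> [] \<Longrightarrow> r t h x' = r' t h x'"
  shows "play \<sigma> r x y t = play \<sigma> r' x y t"
  by (induction t) (auto simp: Let_def assms)

text \<open>Both plays grow at the front, so the initial pair stays the last entry. The robber's
  round counter has to advance together with the history.\<close>

lemma play_Suc_eq_append:
  "play \<sigma> r x y (Suc t) =
     play (shift_strategy \<sigma> (x, y)) (\<lambda>t h. r (Suc t) (h @ [(x, y)]))
       (\<sigma> [(x, y)]) (r 0 [(x, y)] (\<sigma> [(x, y)])) t @ [(x, y)]"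
proof (induction t)
  case 0
  show ?case by (simp add: Let_def)
next
  case (Suc t)
  show ?case
    by (subst play.simps(2), subst Suc) (simp add: Let_def shift_strategy_def)
qed

lemma INF_eSuc:
  fixes A :: "nat set"
  shows "(INF t\<in>A. enat (Suc t)) = 1 + (INF t\<in>A. enat t)"
proof (cases "A = {}")
  case True
  then show ?thesis by (simp add: top_enat_def)
next
  case False
  define m where "m = Inf A"
  have m: "m \<in> A" "\<And>t. t \<in> A \<Longrightarrow> m \<le> t"
    using False unfolding m_def by (auto simp: Inf_nat_def1 intro: cInf_lower)
  have "(INF t\<in>A. enat (Suc t)) = enat (Suc m)"
    by (rule antisym) (use m in \<open>auto intro!: INF_lower INF_greatest\<close>)
  moreover have "(INF t\<in>A. enat t) = enat m"
    by (rule antisym) (use m in \<open>auto intro!: INF_lower INF_greatest\<close>)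
  ultimately show ?thesis by (simp add: one_enat_def)
qed

text \<open>If neither early capture occurs, the capture rounds are the successors of those of the
  restarted play. A capture by the robber's own first move is then a capture at time
  \<open>0\<close> of that play.\<close>

lemma capture_time_play:
  "capture_time (play \<sigma> r x y) =
     (if y \<in> set x then 0 else if y \<in> set (\<sigma> [(x, y)]) then 1
      else 1 + capture_time (play (shift_strategy \<sigma> (x, y)) (\<lambda>t h. r (Suc t) (h @ [(x, y)]))
        (\<sigma> [(x, y)]) (r 0 [(x, y)] (\<sigma> [(x, y)]))))"
proof -
  let ?H = "play \<sigma> r x y"
  let ?H' = "play (shift_strategy \<sigma> (x, y)) (\<lambda>t h. r (Suc t) (h @ [(x, y)]))
        (\<sigma> [(x, y)]) (r 0 [(x, y)] (\<sigma> [(x, y)]))"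
  define S where "S H = {t. snd (hd (H t)) \<in> set (fst (hd (H t))) \<or>
      (\<exists>s. t = Suc s \<and> snd (hd (H s)) \<in> set (fst (hd (H t))))}" for H :: "nat \<Rightarrow> 'a history"
  have ct: "capture_time H = (INF t\<in>S H. enat t)" for H :: "nat \<Rightarrow> 'a history"
    unfolding capture_time_def S_def ..
  have hd0: "hd (?H 0) = (x, y)" by simp
  have hdS: "hd (?H (Suc t)) = hd (?H' t)" for t
    by (subst play_Suc_eq_append) simp
  have hd'0: "hd (?H' 0) = (\<sigma> [(x, y)], r 0 [(x, y)] (\<sigma> [(x, y)]))"
    by simp
  consider "y \<in> set x" | "y \<notin> set x" "y \<in> set (\<sigma> [(x, y)])"
    | "y \<notin> set x" "y \<notin> set (\<sigma> [(x, y)])" by blast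
  then show ?thesis
  proof cases
    case 1
    then have "0 \<in> S ?H" unfolding S_def using hd0 by simp
    then have "capture_time ?H \<le> enat 0" unfolding ct by (rule INF_lower)
    then show ?thesis using 1 by (simp add: zero_enat_def[symmetric])
  next
    case 2
    have "1 \<in> S ?H" unfolding S_def using hd0 hdS[of 0] hd'0 2 by (simp del: play.simps)
    then have "capture_time ?H \<le> enat 1" unfolding ct by (rule INF_lower)
    moreover have "0 \<notin> S ?H" using hd0 2 unfolding S_def by (simp del: play.simps)
    then have "enat 1 \<le> capture_time ?H"
      unfolding ct by (intro INF_greatest) (auto simp: Suc_le_eq intro: gr0I)
    ultimately show ?thesis using 2 by (simp add: one_enat_def)
  next
    case 3
    have "t \<in> S ?H \<longleftrightarrow> t \<in> Suc ` S ?H'" for t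
    proof (cases t)
      case 0
      then show ?thesis using hd0 3 unfolding S_def by (auto simp del: play.simps)
    next
      case (Suc s)
      show ?thesis
      proof (cases s)
        case 0
        then show ?thesis using Suc hd0 hd'0 3 unfolding S_def
          by (auto simp del: play.simps simp: hdS image_iff)
      next
        case (Suc s')
        then show ?thesis using \<open>t = Suc s\<close> unfolding S_def
          by (auto simp del: play.simps simp: hdS image_iff)
      qed
    qed
    then have "S ?H = Suc ` S ?H'" by blast
    then have "capture_time ?H = (INF t\<in>S ?H'. enat (Suc t))"
      unfolding ct by (simp add: image_comp)
    also have "\<dots> = 1 + capture_time ?H'" unfolding INF_eSuc ct ..
    finally show ?thesis using 3 by simp
  qed
qed

section \<open>The expected capture time under a fixed cop strategy\<close>

definition expected_capture_time ::
  "'a pair_pre_digraph \<Rightarrow> 'a cop_strategy \<Rightarrow> 'a list \<Rightarrow> 'a \<Rightarrow> ennreal" where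
  "expected_capture_time G \<sigma> x y =
     (\<integral>\<^sup>+ \<omega>. ennreal_of_enat (capture_time (play \<sigma> (drunk_robber \<omega>) x y)) \<partial>random_moves G)"

lemma capture_time_drunk_robber_SCons:
  assumes "y \<notin> set x" "y \<notin> set (\<sigma> [(x, y)])"
  shows "capture_time (play \<sigma> (drunk_robber (f ## \<omega>)) x y) =
    1 + capture_time (play (shift_strategy \<sigma> (x, y)) (drunk_robber \<omega>) (\<sigma> [(x, y)]) (f y))"
proof -
  have "play (shift_strategy \<sigma> (x, y)) (\<lambda>t h. drunk_robber (f ## \<omega>) (Suc t) (h @ [(x, y)])) x' y' =
      play (shift_strategy \<sigma> (x, y)) (drunk_robber \<omega>) x' y'" for x' y'
    by (rule ext, rule play_cong) (simp add: drunk_robber_def)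
  then show ?thesis
    by (subst capture_time_play) (use assms in \<open>simp add: drunk_robber_def\<close>)
qed

lemma prob_space_random_moves: "prob_space (random_moves G)"
  unfolding random_moves_def
  by (rule prob_space.prob_space_stream_space) (rule measure_pmf.prob_space_axioms)

text \<open>Condition on the first random map: the remaining stream is independent of it and again
  distributed as \<open>random_moves G\<close>. Only the value of the first map at \<open>y\<close>
  matters, and it is uniform on the neighbours of \<open>y\<close>.\<close>

lemma expected_capture_time_step:
  fixes G :: "'a::countable pair_pre_digraph"
  assumes "finite (pverts G)" "y \<in> pverts G" "finite (neighbours G y)" "neighbours G y \<noteq> {}"
  shows "expected_capture_time G \<sigma> x y =
     (if y \<in> set x then 0 else if y \<in> set (\<sigma> [(x, y)]) then 1
      else 1 + (\<Sum>y'\<in>neighbours G y.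
        expected_capture_time G (shift_strategy \<sigma> (x, y)) (\<sigma> [(x, y)]) y') /
          of_nat (card (neighbours G y)))"
proof -
  interpret R: prob_space "random_moves G" by (rule prob_space_random_moves)
  consider "y \<in> set x" | "y \<notin> set x" "y \<in> set (\<sigma> [(x, y)])"
    | "y \<notin> set x" "y \<notin> set (\<sigma> [(x, y)])" by blast
  then show ?thesis
  proof cases
    case 1
    then show ?thesis unfolding expected_capture_time_def
      by (subst capture_time_play) simp
  next
    case 2
    then show ?thesis unfolding expected_capture_time_def
      by (subst capture_time_play) (simp add: R.emeasure_space_1)
  next
    case 3
    let ?p = "Pi_pmf (pverts G) undefined (\<lambda>v. pmf_of_set (neighbours G v))"
    let ?J = "expected_capture_time G (shift_strategy \<sigma> (x, y)) (\<sigma> [(x, y)])"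
    have "expected_capture_time G \<sigma> x y = (\<integral>\<^sup>+ f. \<integral>\<^sup>+ \<omega>. ennreal_of_enat (capture_time
        (play \<sigma> (drunk_robber (f ## \<omega>)) x y)) \<partial>random_moves G \<partial>measure_pmf ?p)"
      unfolding expected_capture_time_def random_moves_def
      by (intro prob_space.nn_integral_stream_space measure_pmf.prob_space_axioms
            measurable_drunk_capture_time[unfolded random_moves_def])
    also have "\<dots> = (\<integral>\<^sup>+ f. 1 + ?J (f y) \<partial>measure_pmf ?p)"
      unfolding capture_time_drunk_robber_SCons[where \<sigma> = \<sigma>, OF 3] expected_capture_time_def
      by (simp add: nn_integral_add R.emeasure_space_1 measurable_drunk_capture_time
            ennreal_of_enat_plus)
    also have "\<dots> = 1 + (\<integral>\<^sup>+ f. ?J (f y) \<partial>measure_pmf ?p)"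
      by (simp add: nn_integral_add)
    also have "(\<integral>\<^sup>+ f. ?J (f y) \<partial>measure_pmf ?p) =
        (\<integral>\<^sup>+ y'. ?J y' \<partial>measure_pmf (map_pmf (\<lambda>f. f y) ?p))"
      by simp
    also have "map_pmf (\<lambda>f. f y) ?p = pmf_of_set (neighbours G y)"
      using assms by (simp add: Pi_pmf_component)
    also have "(\<integral>\<^sup>+ y'. ?J y' \<partial>measure_pmf (pmf_of_set (neighbours G y))) =
        (\<Sum>y'\<in>neighbours G y. ?J y') / of_nat (card (neighbours G y))"
      using assms by (simp add: nn_integral_pmf_of_set)
    finally show ?thesis using 3 by simp
  qed
qed


section \<open>The chasing cop and the adversarial robber\<close>

text \<open>\<open>N\<close> is the number of vertices; truncated subtraction gives
  \<open>N = n\<close> for an empty clique. The bound \<open>3 \<le> n\<close> provides an interior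
  vertex of the path.\<close>

locale lollipop_graph =
  fixes n N :: nat and c :: real
  assumes n_ge: "3 \<le> n" and N_eq: "N = n + (nat \<lfloor>c * real n\<rfloor> - 1)"
begin

abbreviation G :: "nat pair_pre_digraph" where
  "G \<equiv> lollipop n c"

section \<open>Neighbourhoods in the lollipop\<close>

definition proj :: "nat \<Rightarrow> nat" where
  "proj y = min y (n - 1)"

lemma pverts_eq: "pverts G = {..<N}"
  using n_ge unfolding N_eq by (auto simp: lollipop_def Let_def)

lemma n_le_N: "n \<le> N"
  unfolding N_eq by simp

lemma parcs_iff:
  "(i, j) \<in> parcs G \<longleftrightarrow>
     i < n \<and> j < n \<and> (j = Suc i \<or> i = Suc j) \<or>
     n - 1 \<le> i \<and> n - 1 \<le> j \<and> i < N \<and> j < N \<and> i \<noteq> j"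
  using n_ge unfolding N_eq by (auto simp: lollipop_def Let_def)

lemma neighbours_eq:
  assumes "y < N"
  shows "neighbours G y =
    (if y = 0 then {1} else if y < n - 1 then {y - 1, y + 1}
     else if y = n - 1 then insert (n - 2) {n..<N} else {n - 1..<N} - {y})"
  using n_ge n_le_N assms unfolding neighbours_def
  by (auto simp: parcs_iff)

lemma finite_neighbours: "y < N \<Longrightarrow> finite (neighbours G y)"
  by (simp add: neighbours_eq)

lemma neighbours_nonempty:
  assumes "y < N"
  shows "neighbours G y \<noteq> {}"
proof -
  have "(if y = 0 then 1 else if y < n then y - 1 else n - 1) \<in> neighbours G y"
    using assms n_ge by (auto simp: neighbours_eq)
  then show ?thesis by blast
qed

lemma neighbours_lt: "y' \<in> neighbours G y \<Longrightarrow> y' < N"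
  unfolding neighbours_def using n_le_N by (auto simp: parcs_iff)

lemma stay_or_move_lt: "stay_or_move G y y' \<Longrightarrow> y < N \<Longrightarrow> y' < N"
  unfolding stay_or_move_def using neighbours_lt by auto

lemma card_neighbours_pos: "y < N \<Longrightarrow> card (neighbours G y) > 0"
  by (simp add: card_gt_0_iff finite_neighbours neighbours_nonempty)

lemma cop_positions_one: "x \<in> cop_positions G (Suc 0) \<longleftrightarrow> (\<exists>a<N. x = [a])"
  unfolding cop_positions_def pverts_eq by (auto simp: length_Suc_conv)

lemma cop_strategies_oneD:
  assumes "\<sigma> \<in> cop_strategies G 1" "a < N" "y < N"
  obtains a' where "\<sigma> [([a], y)] = [a']" "stay_or_move G a a'" "a' < N"
proof -
  have "list_all2 (stay_or_move G) [a] (\<sigma> [([a], y)])"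
    using assms unfolding cop_strategies_def pverts_eq by (auto simp: cop_positions_one)
  then show thesis using that stay_or_move_lt assms(2)
    by (auto simp: list_all2_Cons1)
qed

text \<open>From \<open>n - 1\<close> on, the cop jumps at once onto a robber with a larger label.
  Lowering a positive label by one follows an edge everywhere, also inside the clique.\<close>

definition chase_step :: "nat \<Rightarrow> nat \<Rightarrow> nat" where
  "chase_step a y =
     (if a < y then (if a < n - 1 then a + 1 else y) else if y < a then a - 1 else a)"

definition chase :: "nat cop_strategy" where
  "chase h = [chase_step (hd (fst (hd h))) (snd (hd h))]"

text \<open>\<open>shift_strategy\<close> preserves the values of \<open>chase\<close> on nonempty
  histories but not on the empty one. This predicate is the form that passes through inductions over
  restarted games.\<close>

definition chasing :: "nat cop_strategy \<Rightarrow> bool" where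
  "chasing \<sigma> \<longleftrightarrow> (\<forall>p h. \<sigma> (p # h) = chase (p # h))"

lemma chasing_shift: "chasing \<sigma> \<Longrightarrow> chasing (shift_strategy \<sigma> p)"
  unfolding chasing_def shift_strategy_def chase_def by simp

lemma chasing_chase: "chasing chase"
  unfolding chasing_def by simp

lemma chasing_single: "chasing \<sigma> \<Longrightarrow> \<sigma> [([a], y)] = [chase_step a y]"
  unfolding chasing_def chase_def by simp

lemma chase_in_cop_strategies: "chase \<in> cop_strategies G 1"
proof -
  have "stay_or_move G a (chase_step a y)" if "a < N" "y < N" for a y
    using that n_ge n_le_N
    unfolding stay_or_move_def neighbours_def chase_step_def by (auto simp: parcs_iff)
  then show ?thesis
    unfolding cop_strategies_def pverts_eq by (auto simp: cop_positions_one chase_def)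
qed

text \<open>In the clique a robber who has not been caught has a larger number than a cop on the path, so the
  linear order of the vertices suffices to say on which side of the cop he is.\<close>

definition rank :: "nat \<Rightarrow> nat \<Rightarrow> nat" where
  "rank a y = (if y = a then 0 else if y < a then a else n - a)"

text \<open>After the cop's step a free robber is strictly beyond the cop's new vertex, and one move
  takes him at most onto it, never past it. So he stays on his side or is caught, while the cop has
  advanced by one.\<close>

lemma rank_chase_step:
  assumes "a < n" "y < N" "y \<noteq> a" "chase_step a y \<noteq> y" "stay_or_move G y y'"
  shows "chase_step a y < n" "rank (chase_step a y) y' < rank a y"
proof -
  have y': "y' = y \<or> (y, y') \<in> parcs G"
    using assms(5) unfolding stay_or_move_def neighbours_def by auto
  show "chase_step a y < n"
    using assms unfolding chase_step_def by (auto split: if_splits)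
  show "rank (chase_step a y) y' < rank a y"
    using assms(1-4) y' unfolding chase_step_def rank_def
    by (auto simp: parcs_iff split: if_splits)
qed

text \<open>Induction on the rank. The rule \<open>r\<close> may depend on the round because the
  restarted game is played with a shifted rule.\<close>

lemma capture_time_chasing:
  assumes "chasing \<sigma>" "a < n" "y < N"
    and "\<And>t x y h x'. y < N \<Longrightarrow> stay_or_move G y (r t ((x, y) # h) x')"
  shows "capture_time (play \<sigma> r [a] y) \<le> enat (rank a y)"
  using assms
proof (induction "rank a y" arbitrary: \<sigma> r a y rule: less_induct)
  case less
  let ?a' = "chase_step a y" and ?y' = "r 0 [([a], y)] [chase_step a y]"
  consider "y = a" | "y \<noteq> a" "?a' = y" | "y \<noteq> a" "?a' \<noteq> y" by blast
  then show ?case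
  proof cases
    case 1
    then show ?thesis by (subst capture_time_play) simp
  next
    case 2
    have "rank a y \<noteq> 0" using 2 less.prems unfolding rank_def by auto
    then show ?thesis using 2 less.prems(1)
      by (subst capture_time_play) (simp add: chasing_single one_enat_def)
  next
    case 3
    have mv: "stay_or_move G y ?y'" using less.prems by auto
    have y': "?y' < N" by (rule stay_or_move_lt[OF mv less.prems(3)])
    have dec: "rank ?a' ?y' < rank a y" "?a' < n"
      using rank_chase_step[OF less.prems(2,3) 3 mv] by auto
    have "capture_time (play (shift_strategy \<sigma> ([a], y)) (\<lambda>t h. r (Suc t) (h @ [([a], y)]))
        [?a'] ?y') \<le> enat (rank ?a' ?y')"
      by (rule less.hyps) (use dec y' less.prems in \<open>auto intro: chasing_shift\<close>)
    also have "1 + enat (rank ?a' ?y') \<le> enat (rank a y)"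
      using dec by (simp add: one_enat_def)
    finally have "1 + capture_time (play (shift_strategy \<sigma> ([a], y))
        (\<lambda>t h. r (Suc t) (h @ [([a], y)])) [?a'] ?y') \<le> enat (rank a y)"
      by (meson add_left_mono order_trans)
    then show ?thesis using 3 less.prems(1)
      by (subst capture_time_play) (simp add: chasing_single)
  qed
qed

lemma capture_time_chase:
  assumes "a < n" "y < N" "\<rho> \<in> robber_strategies G"
  shows "capture_time (play chase (\<lambda>_. \<rho>) [a] y) \<le> enat (rank a y)"
  using assms unfolding robber_strategies_def pverts_eq
  by (intro capture_time_chasing chasing_chase) auto

lemma stay_in_robber_strategies: "(\<lambda>h x'. snd (hd h)) \<in> robber_strategies G"
  unfolding robber_strategies_def stay_or_move_def by auto

section \<open>The cop number and the adversarial capture time\<close>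

lemma cop_number_eq: "cop_number G = 1"
  unfolding cop_number_def
proof (rule Least_equality)
  show "cops_can_win G 1"
    unfolding cops_can_win_def
  proof (intro bexI ballI)
    fix y \<rho> assume "y \<in> pverts G" "\<rho> \<in> robber_strategies G"
    then have "capture_time (play chase (\<lambda>_. \<rho>) [0] y) \<le> enat (rank 0 y)"
      using n_ge by (intro capture_time_chase) (auto simp: pverts_eq)
    also have "\<dots> < \<infinity>" by simp
    finally show "capture_time (play chase (\<lambda>_. \<rho>) [0] y) < \<infinity>" .
  next
    show "[0] \<in> cop_positions G 1"
      using n_ge n_le_N by (auto simp: cop_positions_one)
  qed (rule chase_in_cop_strategies)
next
  fix k assume win: "cops_can_win G k"
  show "1 \<le> k"
  proof (rule ccontr)
    assume "\<not> 1 \<le> k"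
    then have k: "k = 0" by simp
    from win obtain x \<sigma> where x: "x \<in> cop_positions G k" and \<sigma>: "\<sigma> \<in> cop_strategies G k"
      and fin: "\<And>y \<rho>. y \<in> pverts G \<Longrightarrow> \<rho> \<in> robber_strategies G \<Longrightarrow>
        capture_time (play \<sigma> (\<lambda>_. \<rho>) x y) < \<infinity>"
      unfolding cops_can_win_def by blast
    let ?\<rho> = "\<lambda>(h :: nat history) x' :: nat list. snd (hd h)"
    have x0: "x = []" using x k unfolding cop_positions_def by auto
    have y0: "0 \<in> pverts G" using n_ge n_le_N by (simp add: pverts_eq)
    \<comment> \<open>\<open>cop_strategies\<close> restricts \<open>\<sigma>\<close> only on
      histories whose head is legal, so the empty cop list and the robber's vertex are carried
      through the induction together.\<close>
    have "\<exists>h. play \<sigma> (\<lambda>_. ?\<rho>) x 0 t = ([], 0) # h" for t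
    proof (induction t)
      case (Suc t)
      then obtain h where h: "play \<sigma> (\<lambda>_. ?\<rho>) x 0 t = ([], 0) # h" by blast
      have "list_all2 (stay_or_move G) [] (\<sigma> (([], 0) # h))"
        using \<sigma> y0 k unfolding cop_strategies_def cop_positions_def by auto
      then show ?case using h by (simp add: Let_def)
    qed (simp add: x0)
    then have "fst (hd (play \<sigma> (\<lambda>_. ?\<rho>) x 0 t)) = []" for t
      by (metis fst_conv list.sel(1))
    then have "capture_time (play \<sigma> (\<lambda>_. ?\<rho>) x 0) = \<infinity>"
      unfolding capture_time_def by (simp add: top_enat_def)
    then show False using fin[OF y0 stay_in_robber_strategies] by simp
  qed
qed

lemma proj_stay_or_move:
  assumes "stay_or_move G a a'"
  shows "proj a \<le> proj a' + 1" "proj a' \<le> proj a + 1"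
  using assms n_ge unfolding stay_or_move_def neighbours_def proj_def
  by (auto simp: parcs_iff)

text \<open>A cop's move changes his projection by at most one, so a robber who never moves survives
  for at least the projected distance.\<close>

lemma capture_time_staying:
  assumes "\<sigma> \<in> cop_strategies G 1" "a < N" "y < N"
    and "int d \<le> \<bar>int (proj a) - int (proj y)\<bar>"
    and "\<And>t h x'. h \<noteq> [] \<Longrightarrow> r t h x' = snd (hd h)"
  shows "enat d \<le> capture_time (play \<sigma> r [a] y)"
  using assms
proof (induction d arbitrary: \<sigma> r a)
  case 0
  then show ?case by (simp add: zero_enat_def[symmetric])
next
  case (Suc d)
  obtain a' where a': "\<sigma> [([a], y)] = [a']" "stay_or_move G a a'" "a' < N"
    using cop_strategies_oneD Suc.prems(1-3) by blast
  have d': "int d \<le> \<bar>int (proj a') - int (proj y)\<bar>"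
    using Suc.prems(4) proj_stay_or_move[OF a'(2)] by linarith
  have ya: "y \<noteq> a" using Suc.prems(4) by auto
  show ?case
  proof (cases "y = a'")
    case True
    then have "d = 0" using d' by simp
    then show ?thesis using True a' ya by (subst capture_time_play) (simp add: one_enat_def)
  next
    case False
    have "enat d \<le> capture_time (play (shift_strategy \<sigma> ([a], y))
        (\<lambda>t h. r (Suc t) (h @ [([a], y)])) [a'] y)"
      using a' Suc.prems d'
      by (intro Suc.IH) (auto intro: shift_strategy_in_cop_strategies)
    then have "1 + enat d \<le> 1 + capture_time (play (shift_strategy \<sigma> ([a], y))
        (\<lambda>t h. r (Suc t) (h @ [([a], y)])) [a'] y)"
      by (rule add_left_mono)
    then show ?thesis using a' ya False Suc.prems(5)
      by (subst capture_time_play) (simp add: one_enat_def)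
  qed
qed

lemma ct_le: "ct G \<le> enat (n - n div 2)"
proof -
  \<comment> \<open>From the middle of the path the rank is at most \<open>n div 2\<close> on one
    side and \<open>n - n div 2\<close> on the other.\<close>
  let ?a = "n div 2"
  have a: "?a < n" using n_ge by simp
  have "ct G \<le> (SUP y \<in> pverts G. ct_from G 1 [?a] y)"
    unfolding ct_def cop_number_eq ct_with_def
    using a n_le_N by (intro INF_lower) (auto simp: cop_positions_one)
  also have "\<dots> \<le> enat (n - n div 2)"
  proof (rule SUP_least)
    fix y assume y: "y \<in> pverts G"
    have "ct_from G 1 [?a] y \<le>
        (SUP \<rho> \<in> robber_strategies G. capture_time (play chase (\<lambda>_. \<rho>) [?a] y))"
      unfolding ct_from_def by (rule INF_lower) (rule chase_in_cop_strategies)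
    also have "\<dots> \<le> enat (rank ?a y)"
      using a y by (intro SUP_least capture_time_chase) (auto simp: pverts_eq)
    also have "\<dots> \<le> enat (n - n div 2)"
      unfolding rank_def by simp linarith
    finally show "ct_from G 1 [?a] y \<le> enat (n - n div 2)" .
  qed
  finally show ?thesis .
qed

lemma ct_ge: "enat (n div 2) \<le> ct G"
  unfolding ct_def cop_number_eq ct_with_def
proof (rule INF_greatest)
  fix x assume "x \<in> cop_positions G 1"
  then obtain a where a: "a < N" "x = [a]" by (auto simp: cop_positions_one)
  \<comment> \<open>The robber takes an end of the path farthest from the cop's projection.\<close>
  define y where "y = (if n div 2 \<le> proj a then 0 else n - 1)"
  have y: "y \<in> pverts G" "y < N" using n_ge n_le_N by (auto simp: y_def pverts_eq)
  have d: "int (n div 2) \<le> \<bar>int (proj a) - int (proj y)\<bar>"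
    using n_ge unfolding y_def proj_def by auto
  have "enat (n div 2) \<le> ct_from G 1 [a] y"
    unfolding ct_from_def
  proof (rule INF_greatest)
    fix \<sigma> assume \<sigma>: "\<sigma> \<in> cop_strategies G 1"
    have "enat (n div 2) \<le> capture_time (play \<sigma> (\<lambda>_ h x'. snd (hd h)) [a] y)"
      using \<sigma> a y d by (intro capture_time_staying) auto
    also have "\<dots> \<le> (SUP \<rho> \<in> robber_strategies G. capture_time (play \<sigma> (\<lambda>_. \<rho>) [a] y))"
      by (rule SUP_upper2[OF stay_in_robber_strategies]) simp
    finally show "enat (n div 2) \<le>
        (SUP \<rho> \<in> robber_strategies G. capture_time (play \<sigma> (\<lambda>_. \<rho>) [a] y))" .
  qed
  also have "\<dots> \<le> (SUP y \<in> pverts G. ct_from G 1 x y)"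
    using y a by (auto intro: SUP_upper)
  finally show "enat (n div 2) \<le> (SUP y \<in> pverts G. ct_from G 1 x y)" .
qed

end


section \<open>Two-sided bounds for the drunk robber\<close>

context lollipop_graph
begin

lemma proj_le: "proj y \<le> n - 1"
  unfolding proj_def by simp

lemma expected_capture_time_step_lollipop:
  assumes "y < N"
  shows "expected_capture_time G \<sigma> x y =
     (if y \<in> set x then 0 else if y \<in> set (\<sigma> [(x, y)]) then 1
      else 1 + (\<Sum>y'\<in>neighbours G y.
        expected_capture_time G (shift_strategy \<sigma> (x, y)) (\<sigma> [(x, y)]) y') /
          of_nat (card (neighbours G y)))"
  using assms
  by (intro expected_capture_time_step) (auto simp: pverts_eq finite_neighbours neighbours_nonempty)

section \<open>Upper bound: the drunk robber against the chasing cop\<close>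

lemma average_dist_chase_step:
  assumes "a < n" "y < N" "y \<noteq> a" "chase_step a y \<noteq> y"
  shows "(\<Sum>y'\<in>neighbours G y. \<bar>real (chase_step a y) - real (proj y')\<bar>) /
     card (neighbours G y) \<le> \<bar>real a - real (proj y)\<bar> - 1"
proof (cases "0 < y \<and> y < n - 1")
  case True
  then obtain i where i: "y = Suc i" by (cases y) auto
  have nb: "neighbours G y = {i, Suc (Suc i)}" using True assms by (simp add: neighbours_eq i)
  have pr: "proj i = i" "proj (Suc (Suc i)) = Suc (Suc i)" "proj (Suc i) = Suc i"
    using True i unfolding proj_def by auto
  \<comment> \<open>The cop's new vertex is still strictly on one side of the robber, so the
    absolute value is linear on both robber moves: they average out, and the cop gains exactly
    one.\<close>
  have "chase_step a y = a + 1 \<and> a + 1 < y \<or> chase_step a y = a - 1 \<and> y + 1 < a"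
    using assms True unfolding chase_step_def by (auto split: if_splits)
  then show ?thesis unfolding nb by (auto simp: pr i of_nat_diff)
next
  case False
  \<comment> \<open>For a robber outside the interior of the path the bound holds for each neighbour
    separately.\<close>
  have "\<bar>real (chase_step a y) - real (proj y')\<bar> \<le> \<bar>real a - real (proj y)\<bar> - 1"
    if "y' \<in> neighbours G y" for y'
    using False that assms n_ge unfolding neighbours_eq[OF assms(2)] chase_step_def proj_def
    by (auto split: if_splits)
  then have "(\<Sum>y'\<in>neighbours G y. \<bar>real (chase_step a y) - real (proj y')\<bar>) \<le>
      of_nat (card (neighbours G y)) * (\<bar>real a - real (proj y)\<bar> - 1)"
    by (rule sum_bounded_above)
  then show ?thesis
    using card_neighbours_pos[OF assms(2)] by (simp add: divide_le_eq mult.commute)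
qed

text \<open>The rank drops for every robber move, so a finite induction replaces a stopping
  argument. The addend \<open>1\<close> covers a cop at \<open>n - 1\<close> facing a robber
  elsewhere in the clique: the projections agree, yet one round is needed.\<close>

lemma expected_capture_time_chasing_le:
  assumes "chasing \<sigma>" "a < n" "y < N"
  shows "expected_capture_time G \<sigma> [a] y \<le> ennreal (\<bar>real a - real (proj y)\<bar> + 1)"
  using assms
proof (induction "rank a y" arbitrary: \<sigma> a y rule: less_induct)
  case less
  let ?a' = "chase_step a y"
  consider "y = a" | "y \<noteq> a" "?a' = y" | "y \<noteq> a" "?a' \<noteq> y" by blast
  then show ?case
  proof cases
    case 1
    then show ?thesis using less.prems(3) by (simp add: expected_capture_time_step_lollipop)
  next
    case 2
    then show ?thesis using less.prems
      by (simp add: expected_capture_time_step_lollipop chasing_single)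
  next
    case 3
    let ?J = "expected_capture_time G (shift_strategy \<sigma> ([a], y)) [?a']"
    let ?v = "\<lambda>y'. \<bar>real ?a' - real (proj y')\<bar>"
    let ?k = "card (neighbours G y)"
    note k = card_neighbours_pos[OF less.prems(3)]
    have J: "?J y' \<le> ennreal (?v y' + 1)" if "y' \<in> neighbours G y" for y'
    proof (rule less.hyps)
      have mv: "stay_or_move G y y'" using that unfolding stay_or_move_def by simp
      show "rank ?a' y' < rank a y" "?a' < n"
        using rank_chase_step[OF less.prems(2,3) 3 mv] by auto
      show "y' < N" using neighbours_lt[OF that] .
      show "chasing (shift_strategy \<sigma> ([a], y))" using chasing_shift less.prems by blast
    qed
    have avg: "(\<Sum>y'\<in>neighbours G y. ?v y' + 1) / ?k \<le> \<bar>real a - real (proj y)\<bar>"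
      using average_dist_chase_step[OF less.prems(2,3) 3] k
      by (simp add: sum.distrib add_divide_distrib)
    have "expected_capture_time G \<sigma> [a] y = 1 + (\<Sum>y'\<in>neighbours G y. ?J y') / of_nat ?k"
      using 3 less.prems by (simp add: expected_capture_time_step_lollipop chasing_single)
    also have "\<dots> \<le> 1 + (\<Sum>y'\<in>neighbours G y. ennreal (?v y' + 1)) / of_nat ?k"
      by (intro add_left_mono divide_right_mono_ennreal sum_mono J)
    also have "\<dots> = ennreal (1 + (\<Sum>y'\<in>neighbours G y. ?v y' + 1) / ?k)"
      using k by (simp add: sum_ennreal divide_ennreal ennreal_of_nat_eq_real_of_nat sum_nonneg
            ennreal_plus[symmetric] ennreal_1[symmetric] del: ennreal_plus ennreal_1)
    also have "\<dots> \<le> ennreal (\<bar>real a - real (proj y)\<bar> + 1)"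
      using avg by (intro ennreal_leI) simp
    finally show ?thesis .
  qed
qed

section \<open>Lower bound: a projection with small drift\<close>

text \<open>The slope vanishes at both ends of the path, so that all neighbours of an end vertex have the same
  value of \<open>flat_proj\<close>; it changes by at most \<open>1 / A\<close> in one step and is \<open>1\<close> away from the ends.\<close>

definition slope :: "nat \<Rightarrow> nat \<Rightarrow> real" where
  "slope A i = min 1 (min (real i) (real (n - 2) - real i) / real A)"

definition flat_proj :: "nat \<Rightarrow> nat \<Rightarrow> real" where
  "flat_proj A p = (\<Sum>i<p. slope A i)"

text \<open>For \<open>i < n - 1\<close> the defect \<open>1 - slope A i\<close> lies between
  \<open>0\<close> and \<open>1\<close> and vanishes unless \<open>i\<close> is within
  \<open>A\<close> of \<open>0\<close> or of \<open>n - 2\<close>. Each end costs at most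
  \<open>A\<close>; reflection identifies the two counts.\<close>

lemma flat_proj_close:
  assumes "1 \<le> A" "p \<le> n - 1"
  shows "\<bar>flat_proj A p - real p\<bar> \<le> 2 * real A"
proof -
  have s: "0 \<le> 1 - slope A i" for i unfolding slope_def by simp
  have s': "1 - slope A i \<le> of_bool (i < A) + of_bool (n - 1 - Suc i < A)" if "i < n - 1" for i
    using that assms(1) unfolding slope_def
    by (cases "i < A"; cases "n - 1 - Suc i < A")
       (auto simp: min_def field_simps of_nat_diff split: if_splits)
  have card: "(\<Sum>i<n - 1. of_bool (i < A)) \<le> real A"
  proof -
    have "(\<Sum>i<n - 1. of_bool (i < A)) = real (card ({..<n - 1} \<inter> {i. i < A}))"
      by (simp add: of_bool_def sum.If_cases)
    also have "card ({..<n - 1} \<inter> {i. i < A}) \<le> card {..<A}"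
      by (rule card_mono) auto
    finally show ?thesis by simp
  qed
  have "real p - flat_proj A p = (\<Sum>i<p. 1 - slope A i)"
    unfolding flat_proj_def by (simp add: sum_subtractf)
  also have "\<dots> \<le> (\<Sum>i<n - 1. 1 - slope A i)"
    using assms(2) s by (intro sum_mono2) auto
  also have "\<dots> \<le> (\<Sum>i<n - 1. of_bool (i < A) + of_bool (n - 1 - Suc i < A))"
    by (intro sum_mono s') simp
  also have "\<dots> = (\<Sum>i<n - 1. of_bool (i < A)) + (\<Sum>i<n - 1. of_bool (i < A))"
    unfolding sum.distrib
    using sum.nat_diff_reindex[of "\<lambda>i. of_bool (i < A) :: real" "n - 1"] by simp
  also have "\<dots> \<le> 2 * real A" using card by simp
  finally have "real p - flat_proj A p \<le> 2 * real A" .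
  moreover have "0 \<le> (\<Sum>i<p. 1 - slope A i)" using s by (intro sum_nonneg)
  then have "0 \<le> real p - flat_proj A p"
    unfolding flat_proj_def by (simp add: sum_subtractf)
  ultimately show ?thesis by linarith
qed

lemma slope_diff:
  assumes "1 \<le> A"
  shows "\<bar>slope A (Suc i) - slope A i\<bar> \<le> 1 / real A"
proof -
  let ?m = "\<lambda>i. min (real i) (real (n - 2) - real i)"
  have "\<bar>slope A (Suc i) - slope A i\<bar> \<le> \<bar>?m (Suc i) / A - ?m i / A\<bar>"
    unfolding slope_def by (auto simp: min_def)
  also have "\<dots> = \<bar>?m (Suc i) - ?m i\<bar> / A"
    using assms by (simp add: diff_divide_distrib[symmetric] abs_divide)
  also have "\<dots> \<le> 1 / A"
    by (intro divide_right_mono) (auto simp: min_def)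
  finally show ?thesis .
qed

text \<open>In the interior the second difference of \<open>flat_proj\<close> is a difference of
  consecutive slopes, hence at most \<open>1 / A\<close> in absolute value, and convexity of the
  absolute value gives half of that as the loss. Elsewhere all neighbours share the value at
  \<open>y\<close>.\<close>

lemma average_dist_flat_proj:
  assumes A: "1 \<le> A" and y: "y < N"
  shows "\<bar>z - flat_proj A (proj y)\<bar> - 1 / (2 * real A) \<le>
    (\<Sum>y'\<in>neighbours G y. \<bar>z - flat_proj A (proj y')\<bar>) / card (neighbours G y)"
proof (cases "0 < y \<and> y < n - 1")
  case True
  then obtain i where i: "y = Suc i" by (cases y) auto
  have nb: "neighbours G y = {i, Suc (Suc i)}" using True y by (simp add: neighbours_eq i)
  have pr: "proj i = i" "proj (Suc (Suc i)) = Suc (Suc i)" "proj y = Suc i"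
    using True i unfolding proj_def by auto
  have "flat_proj A (Suc (Suc i)) + flat_proj A i - 2 * flat_proj A (Suc i) =
      slope A (Suc i) - slope A i"
    unfolding flat_proj_def by simp
  then have "\<bar>flat_proj A (Suc (Suc i)) + flat_proj A i - 2 * flat_proj A (Suc i)\<bar> \<le> 1 / real A"
    using slope_diff[OF A] by simp
  then show ?thesis unfolding nb by (simp add: pr) argo
next
  case False
  have e0: "flat_proj A 1 = flat_proj A 0"
    unfolding flat_proj_def slope_def by simp
  have "n - 1 = Suc (n - 2)" using n_ge by simp
  then have e1: "flat_proj A (n - 1) = flat_proj A (n - 2)"
    unfolding flat_proj_def slope_def by simp
  have "flat_proj A (proj y') = flat_proj A (proj y)" if "y' \<in> neighbours G y" for y'
    using False that n_ge e0 e1 unfolding neighbours_eq[OF y]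
    by (auto simp: proj_def min_def split: if_splits)
  then show ?thesis
    using card_neighbours_pos[OF y] A by simp
qed

text \<open>The factor \<open>1 + 1 / A\<close> charges twice the drift for each round, and the surplus \<open>1 / (2 A)\<close>
  improves the error term by this amount per unfolded round. Hence \<open>2 A n\<close> unfoldings remove it,
  starting from the trivial bound \<open>n\<close>, whatever the cops do.\<close>

lemma expected_capture_time_ge_aux:
  assumes A: "1 \<le> A"
  assumes "\<sigma> \<in> cop_strategies G 1" "a < N" "y < N" "expected_capture_time G \<sigma> [a] y \<noteq> \<top>"
  shows "\<bar>real (proj a) - flat_proj A (proj y)\<bar> - 2 * real A \<le>
    (1 + 1 / real A) * enn2real (expected_capture_time G \<sigma> [a] y) +
      max 0 (real n - real k * (1 / (2 * real A)))"
  using assms(2-)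
proof (induction k arbitrary: \<sigma> a y)
  case 0
  have "\<bar>flat_proj A (proj y) - real (proj y)\<bar> \<le> 2 * real A"
    by (rule flat_proj_close[OF A proj_le])
  moreover have "real (proj a) \<le> n" "real (proj y) \<le> n" unfolding proj_def by auto
  moreover have "0 \<le> (1 + 1 / real A) * enn2real (expected_capture_time G \<sigma> [a] y)" by simp
  moreover have "max 0 (real n - real 0 * (1 / (2 * real A))) = real n" by simp
  ultimately show ?case by linarith
next
  case (Suc k)
  obtain a' where a': "\<sigma> [([a], y)] = [a']" "stay_or_move G a a'" "a' < N"
    using cop_strategies_oneD Suc.prems(1-3) by blast
  note close = flat_proj_close[OF A proj_le[of y]]
  have move: "\<bar>real (proj a) - real (proj a')\<bar> \<le> 1"
    using proj_stay_or_move[OF a'(2)] by auto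
  consider "y = a" | "y \<noteq> a" "y = a'" | "y \<noteq> a" "y \<noteq> a'" by blast
  then show ?case
  proof cases
    case 1
    have "\<bar>real (proj a) - flat_proj A (proj y)\<bar> - 2 * real A \<le> 0"
      using close unfolding 1 by linarith
    also have "0 \<le> (1 + 1 / real A) * enn2real (expected_capture_time G \<sigma> [a] y) +
        max 0 (real n - real (Suc k) * (1 / (2 * real A)))"
      by (intro add_nonneg_nonneg mult_nonneg_nonneg) auto
    finally show ?thesis .
  next
    case 2
    then have "expected_capture_time G \<sigma> [a] y = 1"
      using Suc.prems a' by (simp add: expected_capture_time_step_lollipop)
    then have "(1 + 1 / real A) * enn2real (expected_capture_time G \<sigma> [a] y) \<ge> 1" by simp
    then show ?thesis using close move unfolding 2(2) by linarith
  next
    case 3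
    let ?J = "expected_capture_time G (shift_strategy \<sigma> ([a], y)) [a']"
    let ?nb = "neighbours G y"
    let ?r = "1 + 1 / real A" and ?\<eta> = "1 / (2 * real A)"
    let ?f = "\<lambda>a y. \<bar>real (proj a) - flat_proj A (proj y)\<bar>"
    let ?e = "max 0 (real n - real k * ?\<eta>)"
    define d where "d = card ?nb"
    define j where "j = (\<Sum>y'\<in>?nb. enn2real (?J y')) / d"
    have d: "0 < d" unfolding d_def using card_neighbours_pos Suc.prems by blast
    have step: "expected_capture_time G \<sigma> [a] y = 1 + (\<Sum>y'\<in>?nb. ?J y') / of_nat d"
      using 3 Suc.prems a' by (simp add: expected_capture_time_step_lollipop d_def)
    \<comment> \<open>A finite average has finite summands, as the induction hypothesis
      requires.\<close>
    have "(\<Sum>y'\<in>?nb. ?J y') \<noteq> \<top>"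
      using step Suc.prems(4) d by (auto simp: ennreal_top_divide)
    then have fin: "?J y' \<noteq> \<top>" if "y' \<in> ?nb" for y'
      using that Suc.prems(3) by (auto simp: finite_neighbours)
    have "(\<Sum>y'\<in>?nb. ?J y') = (\<Sum>y'\<in>?nb. ennreal (enn2real (?J y')))"
      using fin by (intro sum.cong) (auto simp: less_top)
    then have "expected_capture_time G \<sigma> [a] y = ennreal (1 + j)"
      unfolding step j_def using d
      by (simp add: sum_ennreal divide_ennreal ennreal_of_nat_eq_real_of_nat sum_nonneg
            ennreal_plus[symmetric] ennreal_1[symmetric] del: ennreal_plus ennreal_1)
    moreover have "0 \<le> j" unfolding j_def by (intro divide_nonneg_nonneg sum_nonneg) auto
    ultimately have E: "enn2real (expected_capture_time G \<sigma> [a] y) = 1 + j" by simp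
    have "?f a' y' \<le> ?r * enn2real (?J y') + (?e + 2 * real A)" if "y' \<in> ?nb" for y'
    proof -
      have "?f a' y' - 2 * real A \<le> ?r * enn2real (?J y') + ?e"
        using that a' fin Suc.prems neighbours_lt
        by (intro Suc.IH shift_strategy_in_cop_strategies) auto
      then show ?thesis by simp
    qed
    then have "(\<Sum>y'\<in>?nb. ?f a' y') \<le> (\<Sum>y'\<in>?nb. ?r * enn2real (?J y') + (?e + 2 * real A))"
      by (rule sum_mono)
    also have "\<dots> = ?r * (\<Sum>y'\<in>?nb. enn2real (?J y')) + d * (?e + 2 * real A)"
      by (simp add: sum.distrib sum_distrib_left d_def)
    finally have "(\<Sum>y'\<in>?nb. ?f a' y') / d \<le> ?r * j + (?e + 2 * real A)"
      using d unfolding j_def by (simp add: field_simps)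
    then have "?f a' y - ?\<eta> \<le> ?r * j + (?e + 2 * real A)"
      using average_dist_flat_proj[OF A Suc.prems(3), of "real (proj a')"] unfolding d_def
      by linarith
    then have "?f a y - 2 * real A \<le> ?r * j + 1 + ?\<eta> + ?e"
      using move by linarith
    also have "\<dots> = ?r * (1 + j) + (?e - ?\<eta>)"
      by (simp add: algebra_simps add_divide_distrib)
    also have "?e - ?\<eta> \<le> max 0 (real n - real (Suc k) * ?\<eta>)"
      by (auto simp: algebra_simps add_divide_distrib)
    finally show ?thesis unfolding E by simp
  qed
qed

text \<open>Of the error \<open>4 * real A\<close>, one half comes from the preceding bound and one
  half from replacing \<open>flat_proj\<close> by the position itself.\<close>

lemma expected_capture_time_ge:
  assumes A: "1 \<le> A" and "\<sigma> \<in> cop_strategies G 1" "a < N" "y < N"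
  shows "ennreal ((\<bar>real (proj a) - real (proj y)\<bar> - 4 * real A) / (1 + 1 / real A)) \<le>
    expected_capture_time G \<sigma> [a] y"
proof (cases "expected_capture_time G \<sigma> [a] y = \<top>")
  case False
  define k where "k = 2 * A * n"
  have "real n - real k * (1 / (2 * real A)) = 0"
    using A unfolding k_def by simp
  then have "\<bar>real (proj a) - flat_proj A (proj y)\<bar> - 2 * real A \<le>
      (1 + 1 / real A) * enn2real (expected_capture_time G \<sigma> [a] y)"
    using expected_capture_time_ge_aux[OF assms False, of k] by simp
  then have "\<bar>real (proj a) - real (proj y)\<bar> - 4 * real A \<le>
      (1 + 1 / real A) * enn2real (expected_capture_time G \<sigma> [a] y)"
    using flat_proj_close[OF A proj_le[of y]] by linarith
  then have "(\<bar>real (proj a) - real (proj y)\<bar> - 4 * real A) / (1 + 1 / real A) \<le>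
      enn2real (expected_capture_time G \<sigma> [a] y)"
    by (subst pos_divide_le_eq) (auto simp: mult.commute add_pos_nonneg)
  then have "ennreal ((\<bar>real (proj a) - real (proj y)\<bar> - 4 * real A) / (1 + 1 / real A)) \<le>
      ennreal (enn2real (expected_capture_time G \<sigma> [a] y))"
    by (rule ennreal_leI)
  also have "\<dots> = expected_capture_time G \<sigma> [a] y" using False by (simp add: less_top)
  finally show ?thesis .
qed simp

section \<open>From expected capture times to bounds on \<open>dct\<close>\<close>

lemma dct_from_ge:
  assumes "1 \<le> A" "a < N" "y < N"
  shows "ennreal ((\<bar>real (proj a) - real (proj y)\<bar> - 4 * real A) / (1 + 1 / real A)) \<le>
    dct_from G 1 [a] y"
  unfolding dct_from_def
  using expected_capture_time_ge[OF assms(1) _ assms(2,3)]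
  unfolding expected_capture_time_def by (rule INF_greatest)

lemma dct_from_le:
  assumes "a < n" "y < N"
  shows "dct_from G 1 [a] y \<le> ennreal (\<bar>real a - real (proj y)\<bar> + 1)"
  unfolding dct_from_def
  using expected_capture_time_chasing_le[OF chasing_chase assms]
  unfolding expected_capture_time_def by (rule INF_lower2[OF chase_in_cop_strategies])

lemma dct_le:
  assumes "a < n"
  shows "dct G \<le> ennreal ((\<Sum>y<N. \<bar>real a - real (proj y)\<bar>) / N + 1)"
proof -
  have N: "0 < N" using n_ge n_le_N by simp
  have "dct G \<le> (\<Sum>y \<in> pverts G. dct_from G 1 [a] y) / of_nat (card (pverts G))"
    unfolding dct_def cop_number_eq dct_with_def
    using assms n_le_N by (intro INF_lower) (auto simp: cop_positions_one)
  also have "\<dots> \<le> (\<Sum>y<N. ennreal (\<bar>real a - real (proj y)\<bar> + 1)) / of_nat N"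
    unfolding pverts_eq card_lessThan using assms
    by (intro divide_right_mono_ennreal sum_mono dct_from_le) auto
  also have "\<dots> = ennreal ((\<Sum>y<N. \<bar>real a - real (proj y)\<bar> + 1) / N)"
    using N by (simp add: sum_ennreal divide_ennreal ennreal_of_nat_eq_real_of_nat sum_nonneg
        del: ennreal_plus)
  also have "(\<Sum>y<N. \<bar>real a - real (proj y)\<bar> + 1) / N = (\<Sum>y<N. \<bar>real a - real (proj y)\<bar>) / N + 1"
    using N by (simp add: sum.distrib add_divide_distrib)
  finally show ?thesis .
qed

lemma dct_ge:
  assumes A: "1 \<le> A" and s: "\<And>a. a < N \<Longrightarrow> s \<le> (\<Sum>y<N. \<bar>real (proj a) - real (proj y)\<bar>)"
  shows "ennreal ((s / N - 4 * real A) / (1 + 1 / real A)) \<le> dct G"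
  unfolding dct_def cop_number_eq dct_with_def
proof (rule INF_greatest)
  fix x assume "x \<in> cop_positions G 1"
  then obtain a where a: "a < N" "x = [a]" by (auto simp: cop_positions_one)
  have N: "0 < N" using n_ge n_le_N by simp
  let ?r = "1 + 1 / real A"
  have r: "0 < ?r" by (simp add: add_pos_nonneg)
  let ?g = "\<lambda>y. (\<bar>real (proj a) - real (proj y)\<bar> - 4 * real A) / ?r"
  have "(s / N - 4 * real A) / ?r \<le>
      ((\<Sum>y<N. \<bar>real (proj a) - real (proj y)\<bar>) / N - 4 * real A) / ?r"
    using s[OF a(1)] r by (intro divide_right_mono diff_right_mono) auto
  also have "\<dots> = (\<Sum>y<N. ?g y) / N"
    using N by (simp add: sum_divide_distrib[symmetric] sum_subtractf diff_divide_distrib)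
  \<comment> \<open>\<open>?g y\<close> is negative when the robber starts near the cop, and
    \<open>ennreal\<close> is additive only on nonnegative reals. Truncation at \<open>0\<close>
    does not change the value of \<open>ennreal\<close>.\<close>
  also have "\<dots> \<le> (\<Sum>y<N. max 0 (?g y)) / N"
    by (intro divide_right_mono sum_mono) auto
  finally have "ennreal ((s / N - 4 * real A) / ?r) \<le> ennreal ((\<Sum>y<N. max 0 (?g y)) / N)"
    by (rule ennreal_leI)
  also have "\<dots> = (\<Sum>y<N. ennreal (max 0 (?g y))) / of_nat N"
    using N by (subst sum_ennreal) (auto simp: divide_ennreal ennreal_of_nat_eq_real_of_nat sum_nonneg)
  also have "\<dots> \<le> (\<Sum>y<N. dct_from G 1 x y) / of_nat N"
  proof (intro divide_right_mono_ennreal sum_mono)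
    fix y assume "y \<in> {..<N}"
    then have "ennreal (?g y) \<le> dct_from G 1 x y"
      unfolding a(2) using a(1) by (intro dct_from_ge[OF A]) auto
    then show "ennreal (max 0 (?g y)) \<le> dct_from G 1 x y" by (simp only: ennreal_max_0)
  qed
  finally show "ennreal ((s / N - 4 * real A) / ?r) \<le>
      (\<Sum>y \<in> pverts G. dct_from G 1 x y) / of_nat (card (pverts G))"
    by (simp add: pverts_eq)
qed

end


section \<open>Averaging over the initial position\<close>

text \<open>The two sides of \<open>p\<close> contribute the triangular numbers of \<open>p\<close>
  and of \<open>M - p\<close>.\<close>

lemma sum_abs_diff:
  assumes "p \<le> M"
  shows "(\<Sum>y<Suc M. \<bar>real p - real y\<bar>) =
    (real p * (real p + 1) + (real M - real p) * (real M - real p + 1)) / 2"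
  using assms
proof (induction M rule: dec_induct)
  case base
  have "(\<Sum>y<Suc p. \<bar>real p - real y\<bar>) = (\<Sum>y<Suc p. real (Suc p - Suc y))"
    by (intro sum.cong) (auto simp: of_nat_diff)
  also have "\<dots> = (\<Sum>y<Suc p. real y)" by (rule sum.nat_diff_reindex)
  also have "\<dots> = real p * (real p + 1) / 2"
    by (induction p) (auto simp: field_simps)
  finally show ?case by simp
next
  case (step M)
  then show ?case by (simp add: field_simps)
qed

context lollipop_graph
begin

text \<open>The minimum over \<open>0 \<le> p \<le> M\<close> of \<open>p\<^sup>2 / 2 + (M - p)\<^sup>2 / 2 + K (M - p)\<close>, attained at \<open>p = (M + K) / 2\<close>
  if \<open>K \<le> M\<close> and at \<open>p = M\<close> otherwise.\<close>

definition bulk :: real where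
  "bulk = (let M = real n - 1; K = real N - real n in
     if c \<le> 1 then (M\<^sup>2 + 2 * K * M - K\<^sup>2) / 4 else M\<^sup>2 / 2)"

lemma sum_dist_proj:
  assumes "p \<le> n - 1"
  shows "(\<Sum>y<N. \<bar>real p - real (proj y)\<bar>) =
    (real p * (real p + 1) + (real n - 1 - real p) * (real n - real p)) / 2 +
    (real N - real n) * (real n - 1 - real p)"
proof -
  have "{..<N} = {..<n} \<union> {n..<N}" using n_le_N by auto
  then have "(\<Sum>y<N. \<bar>real p - real (proj y)\<bar>) =
      (\<Sum>y<n. \<bar>real p - real (proj y)\<bar>) + (\<Sum>y=n..<N. \<bar>real p - real (proj y)\<bar>)"
    by (simp add: sum.union_disjoint ivl_disj_int)
  also have "(\<Sum>y<n. \<bar>real p - real (proj y)\<bar>) = (\<Sum>y<Suc (n - 1). \<bar>real p - real y\<bar>)"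
    using n_ge by (intro sum.cong) (auto simp: proj_def)
  also have "\<dots> = (real p * (real p + 1) + (real n - 1 - real p) * (real n - real p)) / 2"
    using n_ge by (subst sum_abs_diff[OF assms]) (simp add: of_nat_diff)
  also have "(\<Sum>y=n..<N. \<bar>real p - real (proj y)\<bar>) = (\<Sum>y=n..<N. real n - 1 - real p)"
    using n_ge assms by (intro sum.cong) (auto simp: proj_def min_def)
  also have "\<dots> = (real N - real n) * (real n - 1 - real p)"
    using n_le_N by (simp add: of_nat_diff)
  finally show ?thesis .
qed

text \<open>In the lower bound one unit is lost by rounding and one by the vertex shared with the
  path.\<close>

lemma clique_bounds:
  assumes "0 \<le> c"
  shows "c * real n - 2 \<le> real N - real n" "real N - real n \<le> c * real n"
proof -
  have "0 \<le> c * real n" using assms by simp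
  then have "c * real n - 1 \<le> real (nat \<lfloor>c * real n\<rfloor>)" "real (nat \<lfloor>c * real n\<rfloor>) \<le> c * real n"
    by linarith+
  then show "c * real n - 2 \<le> real N - real n" "real N - real n \<le> c * real n"
    unfolding N_eq by linarith+
qed

text \<open>With \<open>clique_large\<close>, this turns the case distinction on \<open>c\<close> in
  \<open>bulk\<close> into the comparison of \<open>K\<close> and \<open>M\<close> that locates the
  minimum.\<close>

lemma clique_small: "c \<le> 1 \<Longrightarrow> N - n \<le> n - 1"
proof -
  assume "c \<le> 1"
  then have "c * real n \<le> 1 * real n" by (intro mult_right_mono) auto
  then have "\<lfloor>c * real n\<rfloor> \<le> int n" by linarith
  then show ?thesis unfolding N_eq by auto
qed

lemma clique_large: "1 < c \<Longrightarrow> n - 1 \<le> N - n"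
proof -
  assume "1 < c"
  then have "1 * real n \<le> c * real n" by (intro mult_right_mono) auto
  then have "int n \<le> \<lfloor>c * real n\<rfloor>" by linarith
  then show ?thesis unfolding N_eq by auto
qed

lemma bulk_le:
  assumes "p \<le> n - 1"
  shows "bulk \<le> (\<Sum>y<N. \<bar>real p - real (proj y)\<bar>)"
proof -
  have p: "real p \<le> real n - 1" using assms n_ge by linarith
  have n1: "0 \<le> real n - 1" using n_ge by simp
  show ?thesis
  proof (cases "c \<le> 1")
    case True
    \<comment> \<open>Completing the square: the sum exceeds \<open>bulk\<close> by this square plus
      \<open>(real n - 1) / 2\<close>.\<close>
    have "0 \<le> (real p - (real n - 1 + (real N - real n)) / 2)\<^sup>2" by simp
    with True n1 show ?thesis
      unfolding sum_dist_proj[OF assms] bulk_def Let_def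
      by (simp add: power2_eq_square field_simps)
  next
    case False
    then have "real n - 1 \<le> real N - real n" using clique_large n_le_N n_ge by linarith
    \<comment> \<open>Here the excess over \<open>bulk\<close> is this product plus
      \<open>(real n - 1) / 2\<close>.\<close>
    then have "0 \<le> (real n - 1 - real p) * (real N - real n - real p)"
      using p by (intro mult_nonneg_nonneg) auto
    with False n1 show ?thesis
      unfolding sum_dist_proj[OF assms] bulk_def Let_def
      by (simp add: power2_eq_square field_simps)
  qed
qed

lemma bulk_ge:
  obtains p where "p \<le> n - 1" "(\<Sum>y<N. \<bar>real p - real (proj y)\<bar>) \<le> bulk + real n"
proof (cases "c \<le> 1")
  case True
  \<comment> \<open>The real minimizer \<open>(M + K) / 2\<close> equals \<open>(N - 1) / 2\<close>.
    Rounding adds at most \<open>1 / 4\<close>, so with the linear term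
    \<open>(real n - 1) / 2\<close> the excess stays below \<open>real n\<close>.\<close>
  define p where "p = (N - 1) div 2"
  have p: "p \<le> n - 1" using clique_small[OF True] n_le_N unfolding p_def by linarith
  have "\<bar>2 * real p - (real N - 1)\<bar> \<le> 1"
    using n_ge n_le_N unfolding p_def by linarith
  then have "(2 * real p - (real N - 1))\<^sup>2 \<le> 1" by (simp add: abs_square_le_1)
  then have "(\<Sum>y<N. \<bar>real p - real (proj y)\<bar>) \<le> bulk + real n"
    using True unfolding sum_dist_proj[OF p] bulk_def Let_def
    by (simp add: power2_eq_square field_simps)
  with p that show thesis by blast
next
  case False
  have "(\<Sum>y<N. \<bar>real (n - 1) - real (proj y)\<bar>) \<le> bulk + real n"
    using False n_ge unfolding sum_dist_proj[OF order_refl] bulk_def Let_def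
    by (simp add: power2_eq_square field_simps of_nat_diff)
  with that show thesis by blast
qed

lemma dct_le_bulk: "dct G \<le> ennreal ((bulk + real n) / N + 1)"
proof -
  obtain p where p: "p \<le> n - 1" "(\<Sum>y<N. \<bar>real p - real (proj y)\<bar>) \<le> bulk + real n"
    by (rule bulk_ge)
  have "dct G \<le> ennreal ((\<Sum>y<N. \<bar>real p - real (proj y)\<bar>) / N + 1)"
    using p n_ge by (intro dct_le) linarith
  also have "\<dots> \<le> ennreal ((bulk + real n) / N + 1)"
    using p(2) by (intro ennreal_leI add_right_mono divide_right_mono) auto
  finally show ?thesis .
qed

lemma dct_ge_bulk:
  "1 \<le> A \<Longrightarrow> ennreal ((bulk / N - 4 * real A) / (1 + 1 / real A)) \<le> dct G"
  by (intro dct_ge bulk_le proj_le)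

lemma enn2real_dct_bounds:
  assumes "1 \<le> A"
  shows "dct G = ennreal (enn2real (dct G))"
    "enn2real (dct G) \<le> (bulk + real n) / N + 1"
    "(bulk / N - 4 * real A) / (1 + 1 / real A) \<le> enn2real (dct G)"
proof -
  define M K where "M = real n - 1" and "K = real N - real n"
  have MK: "0 \<le> M" "0 \<le> K" "c \<le> 1 \<Longrightarrow> K \<le> M"
    using n_ge n_le_N clique_small unfolding M_def K_def by linarith+
  \<comment> \<open>Nonnegativity of \<open>bulk\<close> makes the upper bound nonnegative, so that
    it can be transferred from \<open>ennreal\<close> to the reals.\<close>
  then have "K\<^sup>2 \<le> M\<^sup>2" if "c \<le> 1" using that by (intro power_mono) auto
  moreover have "0 \<le> K * M" using MK by simp
  ultimately have "0 \<le> bulk"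
    unfolding bulk_def Let_def M_def[symmetric] K_def[symmetric] by auto
  then have nn: "0 \<le> (bulk + real n) / N + 1" by simp
  show fin: "dct G = ennreal (enn2real (dct G))"
    using dct_le_bulk by (metis ennreal_enn2real ennreal_less_top order_le_less_trans)
  show "enn2real (dct G) \<le> (bulk + real n) / N + 1"
    using dct_le_bulk nn by (intro enn2real_leI)
  show "(bulk / N - 4 * real A) / (1 + 1 / real A) \<le> enn2real (dct G)"
    using dct_ge_bulk[OF assms] fin by (metis enn2real_nonneg ennreal_le_iff)
qed

end


section \<open>Asymptotics\<close>

definition dct_rate :: "real \<Rightarrow> real" where
  "dct_rate c = (if c \<le> 1 then (sqrt 2 - 1 + c) * (sqrt 2 + 1 - c) / (4 * (1 + c))
    else 1 / (2 * (1 + c)))"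

text \<open>The product is the difference of squares \<open>2 - (1 - c)\<^sup>2\<close>, which is
  the form in which \<open>bulk\<close> produces it.\<close>

lemma dct_rate_eq:
  "dct_rate c = (if c \<le> 1 then (1 + 2 * c - c\<^sup>2) / 4 else 1 / 2) / (1 + c)"
proof -
  have "(sqrt 2 - 1 + c) * (sqrt 2 + 1 - c) = (sqrt 2)\<^sup>2 - (1 - c)\<^sup>2"
    by (simp add: algebra_simps power2_eq_square)
  then have "(sqrt 2 - 1 + c) * (sqrt 2 + 1 - c) = 1 + 2 * c - c\<^sup>2"
    by (simp add: algebra_simps power2_eq_square)
  then show ?thesis unfolding dct_rate_def by simp
qed

text \<open>Positivity permits division by the rate, both for the relative error and for the cost of
  drunkenness.\<close>

lemma dct_rate_pos: "0 \<le> c \<Longrightarrow> 0 < dct_rate c"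
proof -
  assume c: "0 \<le> c"
  have "0 < 1 + 2 * c - c\<^sup>2" if "c \<le> 1"
    using mult_left_le_one_le[of c c] that c by (simp add: power2_eq_square)
  then show ?thesis unfolding dct_rate_eq using c by auto
qed

definition lollipop_size :: "nat \<Rightarrow> real \<Rightarrow> nat" where
  "lollipop_size n c = n + (nat \<lfloor>c * real n\<rfloor> - 1)"

lemma lollipop_graph: "3 \<le> n \<Longrightarrow> lollipop_graph n (lollipop_size n c) c"
  by unfold_locales (auto simp: lollipop_size_def)

lemma tendsto_dct:
  assumes c: "0 \<le> c"
  shows "(\<lambda>n. enn2real (dct (lollipop n c)) / real n) \<longlonglongrightarrow> dct_rate c"
proof -
  define N where "N n = lollipop_size n c" for n
  define B where "B n = lollipop_graph.bulk n (N n) c" for n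
  \<comment> \<open>This choice makes the additive error \<open>4 * A\<close> of order
    \<open>o(n)\<close> and sends the factor \<open>1 + 1 / A\<close> to \<open>1\<close>.\<close>
  define A where "A n = nat \<lceil>sqrt (real n)\<rceil>" for n
  have L: "lollipop_graph n (N n) c" if "3 \<le> n" for n
    using lollipop_graph[OF that] unfolding N_def .
  have K: "(\<lambda>n. (real (N n) - real n) / real n) \<longlonglongrightarrow> c"
  proof (rule tendsto_sandwich)
    show "\<forall>\<^sub>F n in sequentially. c - 2 / real n \<le> (real (N n) - real n) / real n"
      using eventually_ge_at_top[of 3]
    proof eventually_elim
      case (elim n)
      have "(c * real n - 2) / real n \<le> (real (N n) - real n) / real n"
        by (rule divide_right_mono[OF lollipop_graph.clique_bounds(1)[OF L[OF elim] c]]) simp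
      then show ?case using elim by (simp add: diff_divide_distrib)
    qed
    show "\<forall>\<^sub>F n in sequentially. (real (N n) - real n) / real n \<le> c"
      using eventually_ge_at_top[of 3]
    proof eventually_elim
      case (elim n)
      then show ?case using lollipop_graph.clique_bounds(2)[OF L[OF elim] c]
        by (simp add: pos_divide_le_eq)
    qed
    show "(\<lambda>n. c - 2 / real n) \<longlonglongrightarrow> c" by real_asymp
  qed simp
  have M: "(\<lambda>n. (real n - 1) / real n) \<longlonglongrightarrow> 1" by real_asymp
  have Nlim: "(\<lambda>n. 1 + (real (N n) - real n) / real n) \<longlonglongrightarrow> 1 + c"
    by (intro tendsto_intros K)
  have N: "(\<lambda>n. real (N n) / real n) \<longlonglongrightarrow> 1 + c"
    by (rule Lim_transform_eventually[OF Nlim])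
      (use eventually_gt_at_top[of 0] in eventually_elim, simp add: field_simps)
  define b where "b = (if c \<le> 1 then (1 + 2 * c - c\<^sup>2) / 4 else 1 / 2)"
  \<comment> \<open>\<open>bulk\<close> is homogeneous of degree two in \<open>M\<close> and
    \<open>K\<close>, where \<open>M / n\<close> tends to \<open>1\<close> and \<open>K / n\<close>
    to \<open>c\<close>.\<close>
  have B: "(\<lambda>n. B n / (real n)\<^sup>2) \<longlonglongrightarrow> b"
  proof -
    let ?M = "\<lambda>n. (real n - 1) / real n" and ?K = "\<lambda>n. (real (N n) - real n) / real n"
    have "(\<lambda>n. if c \<le> 1 then ((?M n)\<^sup>2 + 2 * ?K n * ?M n - (?K n)\<^sup>2) / 4 else (?M n)\<^sup>2 / 2)
        \<longlonglongrightarrow> (if c \<le> 1 then (1\<^sup>2 + 2 * c * 1 - c\<^sup>2) / 4 else 1\<^sup>2 / 2)"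
      by (cases "c \<le> 1"; simp only: if_True if_False) (intro tendsto_intros K M; simp)+
    moreover have "\<forall>\<^sub>F n in sequentially.
        (if c \<le> 1 then ((?M n)\<^sup>2 + 2 * ?K n * ?M n - (?K n)\<^sup>2) / 4 else (?M n)\<^sup>2 / 2) =
        B n / (real n)\<^sup>2"
      using eventually_ge_at_top[of 3]
    proof eventually_elim
      case (elim n)
      then show ?case
        unfolding B_def lollipop_graph.bulk_def[OF L[OF elim]] Let_def
        by (simp add: power2_eq_square field_simps)
    qed
    ultimately have "(\<lambda>n. B n / (real n)\<^sup>2)
        \<longlonglongrightarrow> (if c \<le> 1 then (1\<^sup>2 + 2 * c * 1 - c\<^sup>2) / 4 else 1\<^sup>2 / 2)"
      by (rule Lim_transform_eventually)
    then show ?thesis by (cases "c \<le> 1") (simp_all add: b_def)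
  qed
  have rate: "dct_rate c = b / (1 + c)" unfolding dct_rate_eq b_def ..
  have A: "(\<lambda>n. real (A n) / real n) \<longlonglongrightarrow> 0"
  proof (rule tendsto_sandwich[where f = "\<lambda>_. 0"])
    show "\<forall>\<^sub>F n in sequentially. real (A n) / real n \<le> (sqrt (real n) + 1) / real n"
    proof (intro always_eventually allI divide_right_mono)
      show "real (A n) \<le> sqrt (real n) + 1" for n
        using real_sqrt_ge_zero[of "real n"] unfolding A_def by linarith
    qed simp
    show "(\<lambda>n. (sqrt (real n) + 1) / real n) \<longlonglongrightarrow> 0" by real_asymp
  qed auto
  have A': "(\<lambda>n. 1 / real (A n)) \<longlonglongrightarrow> 0"
  proof (rule tendsto_sandwich[where f = "\<lambda>_. 0"])
    show "\<forall>\<^sub>F n in sequentially. 1 / real (A n) \<le> 1 / sqrt (real n)"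
      using eventually_gt_at_top[of 0]
    proof eventually_elim
      case (elim n)
      then have "0 < sqrt (real n)" by simp
      moreover have "sqrt (real n) \<le> real (A n)" unfolding A_def by linarith
      ultimately show ?case by (intro divide_left_mono mult_pos_pos) linarith+
    qed
    show "(\<lambda>n. 1 / sqrt (real n)) \<longlonglongrightarrow> 0" by real_asymp
  qed auto
  have inv: "(\<lambda>n. 1 / real n) \<longlonglongrightarrow> 0" by real_asymp
  have A1: "1 \<le> A n" if "3 \<le> n" for n
    using that unfolding A_def by (simp add: Suc_le_eq)
  show ?thesis
  proof (rule tendsto_sandwich)
    show "\<forall>\<^sub>F n in sequentially.
        ((B n / (real n)\<^sup>2) / (real (N n) / real n) - 4 * (real (A n) / real n)) / (1 + 1 / real (A n))
        \<le> enn2real (dct (lollipop n c)) / real n"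
      using eventually_ge_at_top[of 3]
    proof eventually_elim
      case (elim n)
      have "(B n / N n - 4 * real (A n)) / (1 + 1 / real (A n)) \<le> enn2real (dct (lollipop n c))"
        unfolding B_def by (rule lollipop_graph.enn2real_dct_bounds(3)[OF L[OF elim] A1[OF elim]])
      then have "(B n / N n - 4 * real (A n)) / (1 + 1 / real (A n)) / real n
          \<le> enn2real (dct (lollipop n c)) / real n"
        by (rule divide_right_mono) simp
      then show ?case using elim
        by (simp add: power2_eq_square diff_divide_distrib mult.commute)
    qed
    show "\<forall>\<^sub>F n in sequentially. enn2real (dct (lollipop n c)) / real n \<le>
        (B n / (real n)\<^sup>2 + 1 / real n) / (real (N n) / real n) + 1 / real n"
      using eventually_ge_at_top[of 3]
    proof eventually_elim
      case (elim n)
      have "enn2real (dct (lollipop n c)) \<le> (B n + real n) / N n + 1"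
        unfolding B_def by (rule lollipop_graph.enn2real_dct_bounds(2)[OF L[OF elim] A1[OF elim]])
      then have "enn2real (dct (lollipop n c)) / real n \<le> ((B n + real n) / N n + 1) / real n"
        by (rule divide_right_mono) simp
      then show ?case using elim
        by (simp add: power2_eq_square add_divide_distrib distrib_left mult.commute)
    qed
    have "(\<lambda>n. ((B n / (real n)\<^sup>2) / (real (N n) / real n) - 4 * (real (A n) / real n)) /
        (1 + 1 / real (A n))) \<longlonglongrightarrow> (b / (1 + c) - 4 * 0) / (1 + 0)"
      using c by (intro tendsto_intros B N A A') auto
    then show "(\<lambda>n. ((B n / (real n)\<^sup>2) / (real (N n) / real n) - 4 * (real (A n) / real n)) /
        (1 + 1 / real (A n))) \<longlonglongrightarrow> dct_rate c"
      unfolding rate by simp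
    have "(\<lambda>n. (B n / (real n)\<^sup>2 + 1 / real n) / (real (N n) / real n) + 1 / real n) \<longlonglongrightarrow>
        (b + 0) / (1 + c) + 0"
      using c by (intro tendsto_intros B N inv) auto
    then show "(\<lambda>n. (B n / (real n)\<^sup>2 + 1 / real n) / (real (N n) / real n) + 1 / real n)
        \<longlonglongrightarrow> dct_rate c"
      unfolding rate by simp
  qed
qed

lemma tendsto_ct: "(\<lambda>n. real (the_enat (ct (lollipop n c))) / real n) \<longlonglongrightarrow> 1 / 2"
proof (rule tendsto_sandwich)
  have ct: "real (n div 2) \<le> real (the_enat (ct (lollipop n c)))"
    "real (the_enat (ct (lollipop n c))) \<le> real (n - n div 2)" if n: "3 \<le> n" for n
    using lollipop_graph.ct_le[OF lollipop_graph[OF n, of c]]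
      lollipop_graph.ct_ge[OF lollipop_graph[OF n, of c]]
    by (cases "ct (lollipop n c)"; simp)+
  show "\<forall>\<^sub>F n in sequentially. (real n / 2 - 1) / real n \<le> real (the_enat (ct (lollipop n c))) / real n"
    using eventually_ge_at_top[of 3]
  proof eventually_elim
    case (elim n)
    have "real n / 2 - 1 \<le> real (n div 2)" by linarith
    then show ?case using ct(1)[OF elim] by (intro divide_right_mono) auto
  qed
  show "\<forall>\<^sub>F n in sequentially. real (the_enat (ct (lollipop n c))) / real n \<le> (real n / 2 + 1) / real n"
    using eventually_ge_at_top[of 3]
  proof eventually_elim
    case (elim n)
    have "real (n - n div 2) \<le> real n / 2 + 1" by linarith
    then show ?case using ct(2)[OF elim] by (intro divide_right_mono) auto
  qed
qed real_asymp+

lemma smallo_1I: "f \<longlonglongrightarrow> (0 :: real) \<Longrightarrow> f \<in> o(\<lambda>_. 1)"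
  by (rule smalloI_tendsto) auto

theorem theorem4p2:
  fixes c :: real
  assumes "c \<ge> 0"
  shows "(\<exists>\<epsilon> \<in> o[sequentially](\<lambda>n. 1 :: real). \<forall>\<^sub>F n in sequentially.
           dct (lollipop n c) = ennreal ((1 + \<epsilon> n) *
             (if c \<le> 1 then real n / 4 * ((sqrt 2 - 1 + c) * (sqrt 2 + 1 - c) / (1 + c))
              else real n / (2 * (1 + c)))))
       \<and> (\<exists>\<epsilon> \<in> o[sequentially](\<lambda>n. 1 :: real). \<forall>\<^sub>F n in sequentially.
           cost_of_drunkenness (lollipop n c) = ennreal (
             (if c \<le> 1 then 2 * (1 + c) / ((sqrt 2 - 1 + c) * (sqrt 2 + 1 - c))
              else 1 + c) + \<epsilon> n))"
proof -
  define d where "d n = enn2real (dct (lollipop n c))" for n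
  define k where "k n = the_enat (ct (lollipop n c))" for n
  note pos = dct_rate_pos[OF assms]
  have d: "(\<lambda>n. d n / real n) \<longlonglongrightarrow> dct_rate c"
    unfolding d_def by (rule tendsto_dct[OF assms])
  have k: "(\<lambda>n. real (k n) / real n) \<longlonglongrightarrow> 1 / 2"
    unfolding k_def by (rule tendsto_ct)
  \<comment> \<open>The value \<open>A = 1\<close> is enough, since finiteness does not involve
    \<open>A\<close>.\<close>
  have dct: "dct (lollipop n c) = ennreal (d n)" if "3 \<le> n" for n
    unfolding d_def by (rule lollipop_graph.enn2real_dct_bounds(1)[OF lollipop_graph[OF that] order_refl])
  have ct: "ct (lollipop n c) = enat (k n)" if "3 \<le> n" for n
    using lollipop_graph.ct_le[OF lollipop_graph[OF that, of c]] unfolding k_def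
    by (cases "ct (lollipop n c)") auto
  have main1: "(if c \<le> 1 then real n / 4 * ((sqrt 2 - 1 + c) * (sqrt 2 + 1 - c) / (1 + c))
      else real n / (2 * (1 + c))) = real n * dct_rate c" for n
    unfolding dct_rate_def by simp
  have half: "(1 / 2) / (X / (4 * (1 + c))) = 2 * (1 + c) / X" for X :: real
    by (cases "X = 0") (auto simp: field_simps)
  have main2: "(if c \<le> 1 then 2 * (1 + c) / ((sqrt 2 - 1 + c) * (sqrt 2 + 1 - c)) else 1 + c) =
      (1 / 2) / dct_rate c"
    unfolding dct_rate_def if_distrib[of "(/) (1 / 2)"] half by simp
  show ?thesis
    unfolding main1 main2
  proof (intro conjI bexI)
    \<comment> \<open>The first witness is the relative error of the limit
      \<open>n * dct_rate c\<close>; the second, below, is the quotient of the scaled capture times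
      minus its limit.\<close>
    have "(\<lambda>n. d n / real n / dct_rate c - 1) \<longlonglongrightarrow> dct_rate c / dct_rate c - 1"
      using pos by (intro tendsto_intros d) auto
    then show "(\<lambda>n. d n / real n / dct_rate c - 1) \<in> o(\<lambda>_. 1)"
      using pos by (intro smallo_1I) simp
    show "\<forall>\<^sub>F n in sequentially. dct (lollipop n c) =
        ennreal ((1 + (d n / real n / dct_rate c - 1)) * (real n * dct_rate c))"
      using eventually_ge_at_top[of 3]
      by eventually_elim (use pos in \<open>simp add: dct\<close>)
    have "(\<lambda>n. real (k n) / real n / (d n / real n) - (1 / 2) / dct_rate c) \<longlonglongrightarrow>
        (1 / 2) / dct_rate c - (1 / 2) / dct_rate c"
      using pos by (intro tendsto_intros d k) auto
    then show "(\<lambda>n. real (k n) / real n / (d n / real n) - (1 / 2) / dct_rate c) \<in> o(\<lambda>_. 1)"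
      by (intro smallo_1I) simp
    \<comment> \<open>A positive denominator makes the division in \<open>ennreal\<close> agree with
      real division.\<close>
    have "\<forall>\<^sub>F n in sequentially. 0 < d n / real n"
      using d pos by (rule order_tendstoD)
    then show "\<forall>\<^sub>F n in sequentially. cost_of_drunkenness (lollipop n c) =
        ennreal ((1 / 2) / dct_rate c + (real (k n) / real n / (d n / real n) - (1 / 2) / dct_rate c))"
      using eventually_ge_at_top[of 3]
    proof eventually_elim
      case (elim n)
      then have "0 < d n" by (simp add: zero_less_divide_iff)
      then show ?case using elim
        by (simp add: cost_of_drunkenness_def dct ct ennreal_of_nat_eq_real_of_nat divide_ennreal)
    qed
  qed
qed


end
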